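(* The integrality gap of the configuration LP for Maximum Budgeted Allocation is at most $2(\sqrt{2}-1)\approx 0.828$. That is, for every $\eta>0$ there is an MBA instance for which (optimal integral value)/(optimal value of the configuration LP) is at most $2(\sqrt{2}-1)+\eta$.
   Context: Maximum Budgeted Allocation (MBA): an instance consists of a finite set $\mathcal{A}$ of players, a finite set $\mathcal{Q}$ of indivisible items, a budget $B_i$ for each player $i$, and a price $0\le p_{ij}\le B_i$ of each item $j$ for each player $i$. The goal is to find pairwise disjoint sets $S_i\subseteq\mathcal{Q}$ ($i\in\mathcal{A}$) maximizing $\sum_{i\in\mathcal{A}}\min\{\sum_{j\in S_i}p_{ij},B_i\}$. Configuration LP: with $w_i(\mathcal{C})=\min\{\sum_{j\in\mathcal{C}}p_{ij},B_i\}$ for $\mathcal{C}\subseteq\mathcal{Q}$, maximize $\sum_{i\in\mathcal{A}}\sum_{\mathcal{C}\subseteq\mathcal{Q}}w_i(\mathcal{C})y_{i\mathcal{C}}$ subject to $\sum_{\mathcal{C}\subseteq\mathcal{Q}}y_{i\mathcal{C}}\le 1$ for all $i\in\mathcal{A}$, $\sum_{i\in\mathcal{A},\,\mathcal{C}\ni j}y_{i\mathcal{C}}\le 1$ for all $j\in\mathcal{Q}$, and $y\ge 0$. The integrality gap is the infimum over instances (with positive LP value) of (optimal integral value)/(optimal LP value). *)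

theory Defs
  imports Complex_Main "HOL-Library.Disjoint_Sets"
begin

record ('a, 'q) mba =
  players :: "'a set"
  items :: "'q set"
  budget :: "'a \<Rightarrow> real"
  price :: "'a \<Rightarrow> 'q \<Rightarrow> real"

text \<open>
  Nonnegativity of the budgets follows from the price bounds as soon as there is an item; it is
  stated separately only to exclude negative budgets in instances without items.
\<close>

definition mba_instance :: "('a, 'q) mba \<Rightarrow> bool" where
  "mba_instance I \<longleftrightarrow>
     finite (players I) \<and> finite (items I) \<and>
     (\<forall>i\<in>players I. 0 \<le> budget I i) \<and>
     (\<forall>i\<in>players I. \<forall>j\<in>items I. 0 \<le> price I i j \<and> price I i j \<le> budget I i)"

definition config_value :: "('a, 'q) mba \<Rightarrow> 'a \<Rightarrow> 'q set \<Rightarrow> real" where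
  "config_value I i C = min (\<Sum>j\<in>C. price I i j) (budget I i)"

definition allocations :: "('a, 'q) mba \<Rightarrow> ('a \<Rightarrow> 'q set) set" where
  "allocations I =
     {S. (\<forall>i\<in>players I. S i \<subseteq> items I) \<and> disjoint_family_on S (players I)}"

definition allocation_value :: "('a, 'q) mba \<Rightarrow> ('a \<Rightarrow> 'q set) \<Rightarrow> real" where
  "allocation_value I S = (\<Sum>i\<in>players I. config_value I i (S i))"

definition opt_integral :: "('a, 'q) mba \<Rightarrow> real" where
  "opt_integral I = (SUP S\<in>allocations I. allocation_value I S)"

definition config_lp_feasible :: "('a, 'q) mba \<Rightarrow> ('a \<Rightarrow> 'q set \<Rightarrow> real) set" where
  "config_lp_feasible I =
     {y. (\<forall>i\<in>players I. (\<Sum>C\<in>Pow (items I). y i C) \<le> 1) \<and>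
         (\<forall>j\<in>items I. (\<Sum>i\<in>players I. \<Sum>C\<in>{C \<in> Pow (items I). j \<in> C}. y i C) \<le> 1) \<and>
         (\<forall>i\<in>players I. \<forall>C\<in>Pow (items I). 0 \<le> y i C)}"

definition config_lp_value :: "('a, 'q) mba \<Rightarrow> ('a \<Rightarrow> 'q set \<Rightarrow> real) \<Rightarrow> real" where
  "config_lp_value I y = (\<Sum>i\<in>players I. \<Sum>C\<in>Pow (items I). config_value I i C * y i C)"

definition opt_config_lp :: "('a, 'q) mba \<Rightarrow> real" where
  "opt_config_lp I = (SUP y\<in>config_lp_feasible I. config_lp_value I y)"

text \<open>
  Players and items are finite sets, so labelling them by natural numbers loses no generality.
\<close>

definition config_lp_integrality_gap :: real where
  "config_lp_integrality_gap =
     Inf {opt_integral I / opt_config_lp I | I :: (nat, nat) mba.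
            mba_instance I \<and> 0 < opt_config_lp I}"

text \<open>
  The suprema above are over nonempty sets that are bounded above for every instance, so
  neither optimum is an unspecified value of the real-valued supremum.
\<close>

lemma allocations_nonempty: "allocations I \<noteq> {}"
proof -
  have "(\<lambda>_. {}) \<in> allocations I"
    by (simp add: allocations_def disjoint_family_on_def)
  then show ?thesis by blast
qed

lemma config_lp_feasible_nonempty: "config_lp_feasible I \<noteq> {}"
proof -
  have "(\<lambda>_ _. 0) \<in> config_lp_feasible I"
    by (simp add: config_lp_feasible_def)
  then show ?thesis by blast
qed

lemma bdd_above_allocation_value: "bdd_above (allocation_value I ` allocations I)"
proof (rule bdd_aboveI2)
  fix S
  show "allocation_value I S \<le> (\<Sum>i\<in>players I. budget I i)"
    unfolding allocation_value_def config_value_def by (intro sum_mono) simp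
qed

lemma bdd_above_config_lp_value:
  assumes "mba_instance I"
  shows "bdd_above (config_lp_value I ` config_lp_feasible I)"
proof (rule bdd_aboveI2)
  fix y assume y: "y \<in> config_lp_feasible I"
  have "(\<Sum>C\<in>Pow (items I). config_value I i C * y i C) \<le> budget I i"
    if i: "i \<in> players I" for i
  proof -
    have "(\<Sum>C\<in>Pow (items I). config_value I i C * y i C)
            \<le> (\<Sum>C\<in>Pow (items I). budget I i * y i C)"
      using y i by (intro sum_mono mult_right_mono)
        (auto simp: config_lp_feasible_def config_value_def)
    also have "\<dots> = budget I i * (\<Sum>C\<in>Pow (items I). y i C)"
      by (simp add: sum_distrib_left)
    also have "\<dots> \<le> budget I i * 1"
      using y i assms by (intro mult_left_mono)
        (auto simp: config_lp_feasible_def mba_instance_def)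
    finally show ?thesis by simp
  qed
  then show "config_lp_value I y \<le> (\<Sum>i\<in>players I. budget I i)"
    unfolding config_lp_value_def by (intro sum_mono)
qed

end

theory Submission imports Defs "HOL-Library.Nat_Bijection" begin

text \<open>
  Take n groups, each consisting of a big player with budget n, of p small players with budget 1
  and of n small items, which are worth 1 to every player of the group. In addition p big items
  are worth n to every big player. Fractionally everyone is saturated: a big player gets each big
  item with weight 1/n and all small items of its group with weight 1 - p/n, while a small player
  gets each single item of its group with weight 1/n. The value is n^2 + np. Integrally, a group
  without a big item earns at most n, and at most p groups earn n + p, so the value is at most
  n^2 + p^2. With t = p/n the ratio is (1 + t^2)/(1 + t), which is minimal at t = sqrt 2 - 1.
\<close>

section \<open>General bounds for the LP optimum and for the gap\<close>

text \<open>Giving weight 1/n to each of the configurations \<open>c i 0\<close>, ...,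
  \<open>c i (n - 1)\<close> of every player \<open>i\<close> is feasible: \<open>cap\<close> is the
  item constraint scaled by n. LP solutions can thus be checked by counting.\<close>

lemma opt_config_lp_ge_uniform:
  fixes c :: "'a \<Rightarrow> nat \<Rightarrow> 'q set"
  assumes I: "mba_instance I" and n: "0 < n"
    and c: "\<And>i k. \<lbrakk>i \<in> players I; k < n\<rbrakk> \<Longrightarrow> c i k \<subseteq> items I"
    and cap: "\<And>j. j \<in> items I \<Longrightarrow> (\<Sum>i\<in>players I. card {k. k < n \<and> j \<in> c i k}) \<le> n"
  shows "(\<Sum>i\<in>players I. \<Sum>k<n. config_value I i (c i k)) / n \<le> opt_config_lp I"
proof -
  \<comment> \<open>Summing over indices lets a configuration listed several times collect its
    weight once per occurrence.\<close>
  define y where "y i C = (\<Sum>k<n. if C = c i k then 1 / real n else 0)" for i C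
  have fin: "finite (Pow (items I))"
    using I by (simp add: mba_instance_def)
  \<comment> \<open>The constraints use this with \<open>f\<close> constantly 1, the objective with
    \<open>f\<close> the configuration value.\<close>
  have sum_y: "(\<Sum>C\<in>F. f C * y i C) = (\<Sum>k<n. if c i k \<in> F then f (c i k) / n else 0)"
    if "finite F" for F i and f :: "'q set \<Rightarrow> real"
  proof -
    have "(\<Sum>C\<in>F. f C * y i C) = (\<Sum>k<n. \<Sum>C\<in>F. if C = c i k then f C / n else 0)"
      by (subst sum.swap) (auto simp: y_def sum_distrib_left intro!: sum.cong)
    then show ?thesis
      using that by (simp add: sum.delta)
  qed
  have "y \<in> config_lp_feasible I"
    unfolding config_lp_feasible_def
  proof (intro CollectI conjI ballI)
    fix i assume "i \<in> players I"
    then show "(\<Sum>C\<in>Pow (items I). y i C) \<le> 1"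
      using sum_y[OF fin, of "\<lambda>_. 1" i] c n by simp
  next
    fix j assume j: "j \<in> items I"
    have "(\<Sum>C\<in>{C \<in> Pow (items I). j \<in> C}. y i C) = card {k. k < n \<and> j \<in> c i k} / n"
      if i: "i \<in> players I" for i
    proof -
      have "(\<Sum>C\<in>{C \<in> Pow (items I). j \<in> C}. y i C)
          = (\<Sum>k<n. if j \<in> c i k then 1 / n else 0)"
        using sum_y[of "{C \<in> Pow (items I). j \<in> C}" "\<lambda>_. 1" i] fin c[OF i]
        by (auto intro!: sum.cong)
      also have "\<dots> = (\<Sum>k\<in>{k. k < n \<and> j \<in> c i k}. 1 / n)"
        by (subst sum.inter_filter[symmetric]) (auto intro!: sum.cong)
      finally show ?thesis by simp
    qed
    then have "(\<Sum>i\<in>players I. \<Sum>C\<in>{C \<in> Pow (items I). j \<in> C}. y i C)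
        = real (\<Sum>i\<in>players I. card {k. k < n \<and> j \<in> c i k}) / n"
      by (simp add: sum_divide_distrib)
    then show "(\<Sum>i\<in>players I. \<Sum>C\<in>{C \<in> Pow (items I). j \<in> C}. y i C) \<le> 1"
      using cap[OF j] n by (simp del: of_nat_sum)
  qed (auto simp: y_def intro!: sum_nonneg)
  then have "config_lp_value I y \<le> opt_config_lp I"
    unfolding opt_config_lp_def using bdd_above_config_lp_value[OF I] by (rule cSUP_upper)
  moreover have "config_lp_value I y = (\<Sum>i\<in>players I. \<Sum>k<n. config_value I i (c i k)) / n"
    unfolding config_lp_value_def sum_divide_distrib
    using c by (intro sum.cong refl) (auto simp: sum_y[OF fin] intro!: sum.cong)
  ultimately show ?thesis by simp
qed

lemma opt_integral_nonneg:
  assumes "mba_instance I"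
  shows "0 \<le> opt_integral I"
proof -
  have "(\<lambda>_. {}) \<in> allocations I"
    by (simp add: allocations_def disjoint_family_on_def)
  then have "allocation_value I (\<lambda>_. {}) \<le> opt_integral I"
    unfolding opt_integral_def using bdd_above_allocation_value by (rule cSUP_upper)
  moreover have "0 \<le> allocation_value I (\<lambda>_. {})"
    using assms by (auto simp: allocation_value_def config_value_def mba_instance_def intro!: sum_nonneg)
  ultimately show ?thesis by linarith
qed

lemma config_lp_integrality_gap_le:
  fixes I :: "(nat, nat) mba"
  assumes "mba_instance I" and "0 < opt_config_lp I"
  shows "config_lp_integrality_gap \<le> opt_integral I / opt_config_lp I"
  unfolding config_lp_integrality_gap_def
proof (rule cInf_lower)
  \<comment> \<open>A real infimum bounds its set from below only if some lower bound exists; here 0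
    is one.\<close>
  show "bdd_below {opt_integral I / opt_config_lp I | I :: (nat, nat) mba.
      mba_instance I \<and> 0 < opt_config_lp I}"
    by (rule bdd_belowI[of _ 0]) (auto intro!: divide_nonneg_pos opt_integral_nonneg)
qed (use assms in blast)

section \<open>The instances with n groups\<close>

text \<open>
  Player (i, 0) is the big player and player (i, l) with l > 0 a small player of group i < n.
  Item (i, j) with i < n is a small item of group i, and the items (n, j) are the big ones.
\<close>

definition group_budget :: "nat \<Rightarrow> nat \<times> nat \<Rightarrow> real" where
  "group_budget n a = (if snd a = 0 then n else 1)"

definition group_price :: "nat \<Rightarrow> nat \<times> nat \<Rightarrow> nat \<times> nat \<Rightarrow> real" where
  "group_price n a q =
     (if fst q = fst a then 1 else if fst q = n \<and> snd a = 0 then n else 0)"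

definition group_players :: "nat \<Rightarrow> nat \<Rightarrow> (nat \<times> nat) set" where
  "group_players n p = {..<n} \<times> {..p}"

definition group_items :: "nat \<Rightarrow> nat \<Rightarrow> (nat \<times> nat) set" where
  "group_items n p = {..<n} \<times> {..<n} \<union> {n} \<times> {..<p}"

text \<open>Pairs are coded as numbers because the gap ranges over instances labelled by
  \<open>nat\<close>.\<close>

definition group_instance :: "nat \<Rightarrow> nat \<Rightarrow> (nat, nat) mba" where
  "group_instance n p =
     \<lparr>players = prod_encode ` group_players n p,
      items = prod_encode ` group_items n p,
      budget = (\<lambda>a. group_budget n (prod_decode a)),
      price = (\<lambda>a q. group_price n (prod_decode a) (prod_decode q))\<rparr>"

lemma mba_instance_group_instance: "mba_instance (group_instance n p)"
  by (auto simp: mba_instance_def group_instance_def group_players_def group_items_def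
      group_budget_def group_price_def)

lemma sum_players_group_instance:
  "(\<Sum>a\<in>players (group_instance n p). f a) = (\<Sum>i<n. \<Sum>l\<le>p. f (prod_encode (i, l)))"
  by (simp add: group_instance_def group_players_def sum.reindex inj_prod_encode
      sum.cartesian_product)

lemma config_value_group_instance:
  "config_value (group_instance n p) (prod_encode a) (prod_encode ` D)
     = min (\<Sum>q\<in>D. group_price n a q) (group_budget n a)"
  by (simp add: config_value_def group_instance_def sum.reindex inj_prod_encode)

section \<open>The fractional optimum\<close>

text \<open>All budgets are exhausted: n groups contribute n + p each. No item is overused, as each
  occurs in exactly n of the listed configurations.\<close>

lemma opt_config_lp_group_instance:
  assumes p: "p \<le> n" and n: "0 < n"
  shows "real (n * n + n * p) \<le> opt_config_lp (group_instance n p)"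
proof -
  define I where "I = group_instance n p"
  \<comment> \<open>The index \<open>k\<close> picks the same big item for all big players, so each
    big item is used once per group.\<close>
  define d where "d a k = (if snd a = 0 then if k < p then {(n, k)} else {fst a} \<times> {..<n}
      else {(fst a, k)})" for a :: "nat \<times> nat" and k
  define c where "c a k = prod_encode ` d (prod_decode a) k" for a k
  have val: "config_value I (prod_encode (i, l)) (c (prod_encode (i, l)) k) = (if l = 0 then n else 1)"
    if "i < n" "k < n" for i l k
  proof -
    have "(\<Sum>q\<in>d (i, l) k. group_price n (i, l) q) = (if l = 0 then n else 1)"
      using that by (auto simp: d_def group_price_def sum.cartesian_product')
    then show ?thesis
      using that by (simp add: I_def c_def config_value_group_instance group_budget_def)
  qed
  have cap: "(\<Sum>a\<in>players I. card {k. k < n \<and> j \<in> c a k}) \<le> n" if j: "j \<in> items I" for j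
  proof -
    obtain g m where gm: "(g, m) \<in> group_items n p" and j_eq: "j = prod_encode (g, m)"
      using j by (auto simp: I_def group_instance_def)
    have mem: "j \<in> c (prod_encode a) k \<longleftrightarrow> (g, m) \<in> d a k" for a k
      by (auto simp: j_eq c_def inj_image_mem_iff)
    have eq: "(\<Sum>a\<in>players I. card {k. k < n \<and> j \<in> c a k})
        = (\<Sum>i<n. \<Sum>l\<le>p. card {k. k < n \<and> (g, m) \<in> d (i, l) k})"
      by (simp only: I_def sum_players_group_instance mem)
    show ?thesis
    proof (cases "g = n")
      case True
      then have m: "m < p"
        using gm by (auto simp: group_items_def)
      have "{k. k < n \<and> (g, m) \<in> d (i, l) k} = (if l = 0 then {m} else {})" if "i < n" for i l
        using that True m p by (auto simp: d_def split: if_splits)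
      then have "(\<Sum>a\<in>players I. card {k. k < n \<and> j \<in> c a k})
          = (\<Sum>i<n. \<Sum>l\<le>p. if l = 0 then 1 else 0)"
        unfolding eq by (intro sum.cong refl) simp
      then show ?thesis by simp
    next
      case False
      then have g: "g < n" and m: "m < n"
        using gm by (auto simp: group_items_def)
      \<comment> \<open>Only the players of group \<open>g\<close> use a small item of that group:
        the big one in its last n - p configurations, a small one just in configuration
        \<open>m\<close>.\<close>
      have "{k. k < n \<and> (g, m) \<in> d (i, l) k}
          = (if i = g then if l = 0 then {p..<n} else {m} else {})" if "i < n" for i l
        using that g m by (auto simp: d_def split: if_splits)
      then have "(\<Sum>a\<in>players I. card {k. k < n \<and> j \<in> c a k})
          = (\<Sum>i<n. if i = g then \<Sum>l\<le>p. if l = 0 then n - p else 1 else 0)"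
        unfolding eq by (intro sum.cong refl) (auto intro!: sum.cong)
      also have "\<dots> = (\<Sum>l\<le>p. if l = 0 then n - p else 1)"
        using g by simp
      \<comment> \<open>The p small players make up for the p uses missing from the big one;
        \<open>p \<le> n\<close> keeps the natural subtraction exact.\<close>
      also have "\<dots> = n"
        using p by (simp add: sum.atMost_shift)
      finally show ?thesis by simp
    qed
  qed
  have "(\<Sum>a\<in>players I. \<Sum>k<n. config_value I a (c a k)) / n \<le> opt_config_lp I"
  proof (rule opt_config_lp_ge_uniform[OF _ n _ cap])
    show "c a k \<subseteq> items I" if "a \<in> players I" "k < n" for a k
      using that by (auto simp: I_def group_instance_def group_players_def group_items_def
          c_def d_def)
  qed (simp_all add: I_def mba_instance_group_instance)
  also have "(\<Sum>a\<in>players I. \<Sum>k<n. config_value I a (c a k))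
      = (\<Sum>i<n. \<Sum>l\<le>p. \<Sum>k<n. real (if l = 0 then n else 1))"
    unfolding I_def sum_players_group_instance
    by (intro sum.cong refl val[unfolded I_def]) auto
  also have "\<dots> / n = n * n + n * p"
    using n by (simp add: sum.atMost_shift field_simps)
  finally show ?thesis by (simp add: I_def)
qed

section \<open>The integral optimum\<close>

lemma opt_integral_group_instance:
  "opt_integral (group_instance n p) \<le> real (n * n + p * p)"
  unfolding opt_integral_def
proof (rule cSUP_least[OF allocations_nonempty])
  fix S assume S: "S \<in> allocations (group_instance n p)"
  define T where "T a = prod_decode ` S (prod_encode a)" for a
  have S_eq: "S (prod_encode a) = prod_encode ` T a" for a
    by (simp add: T_def image_comp comp_def)
  have sub: "T a \<subseteq> group_items n p" if "a \<in> group_players n p" for a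
    using S that by (fastforce simp: allocations_def group_instance_def T_def)
  have disj: "T a \<inter> T b = {}"
    if "a \<in> group_players n p" "b \<in> group_players n p" "a \<noteq> b" for a b
  proof -
    have "S (prod_encode a) \<inter> S (prod_encode b) = {}"
      using S that by (auto simp: allocations_def group_instance_def disjoint_family_on_def)
    then show ?thesis
      unfolding S_eq by auto
  qed
  have fin: "finite (group_items n p)"
    by (simp add: group_items_def)
  define v where "v a = config_value (group_instance n p) (prod_encode a) (S (prod_encode a))" for a
  \<comment> \<open>Only big players matter here, since big items are worthless to small
    ones.\<close>
  define R where "R = {i. i < n \<and> T (i, 0) \<inter> {n} \<times> {..<p} \<noteq> {}}"
  have v_eq: "v a = min (\<Sum>q\<in>T a. group_price n a q) (group_budget n a)" for a
    unfolding v_def S_eq config_value_group_instance ..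
  have without_big: "(\<Sum>l\<le>p. v (i, l)) \<le> n" if i: "i < n" "i \<notin> R" for i
  proof -
    have fin_T: "finite (T (i, l))" if "l \<le> p" for l
      using sub[of "(i, l)"] i that fin by (auto simp: group_players_def intro: finite_subset)
    \<comment> \<open>The budget cap is dropped. Every item that counts has price 1: for
      \<open>l = 0\<close> because \<open>i\<close> is outside \<open>R\<close>, for
      \<open>l > 0\<close> because big items have price 0.\<close>
    have "v (i, l) \<le> card (T (i, l) \<inter> {i} \<times> {..<n})" if l: "l \<le> p" for l
    proof -
      have "v (i, l) \<le> (\<Sum>q\<in>T (i, l). group_price n (i, l) q)"
        by (simp add: v_eq)
      also have "\<dots> = (\<Sum>q\<in>T (i, l). if q \<in> {i} \<times> {..<n} then 1 else 0)"
        using sub[of "(i, l)"] i l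
        by (intro sum.cong refl) (auto simp: group_price_def group_players_def group_items_def R_def)
      also have "\<dots> = card (T (i, l) \<inter> {i} \<times> {..<n})"
        using fin_T[OF l] by (subst sum.inter_restrict[symmetric]) auto
      finally show ?thesis .
    qed
    then have "(\<Sum>l\<le>p. v (i, l)) \<le> real (\<Sum>l\<le>p. card (T (i, l) \<inter> {i} \<times> {..<n}))"
      unfolding of_nat_sum by (intro sum_mono) simp
    \<comment> \<open>The bundles of a group are disjoint, so together they hold at most its n small
      items.\<close>
    also have "(\<Sum>l\<le>p. card (T (i, l) \<inter> {i} \<times> {..<n})) = card (\<Union>l\<le>p. T (i, l) \<inter> {i} \<times> {..<n})"
      using disj[of "(i, l)" "(i, l')" for l l'] i(1) fin_T
      by (subst card_UN_disjoint) (auto simp: group_players_def set_eq_iff)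
    also have "\<dots> \<le> card ({i} \<times> {..<n})"
      by (intro card_mono) auto
    finally show ?thesis by simp
  qed
  have with_big: "(\<Sum>l\<le>p. v (i, l)) \<le> n + p" for i
  proof -
    have "(\<Sum>l\<le>p. v (i, l)) \<le> (\<Sum>l\<le>p. group_budget n (i, l))"
      by (intro sum_mono) (simp add: v_eq)
    then show ?thesis
      by (simp add: group_budget_def sum.atMost_shift)
  qed
  have card_R: "card R \<le> p"
  proof -
    \<comment> \<open>Each group in \<open>R\<close> holds at least one of the p big items, and no
      two groups share one.\<close>
    have "card R \<le> (\<Sum>i\<in>R. card (T (i, 0) \<inter> {n} \<times> {..<p}))"
      unfolding card_eq_sum by (intro sum_mono) (auto simp: R_def Suc_le_eq card_gt_0_iff)
    also have "\<dots> = card (\<Union>i\<in>R. T (i, 0) \<inter> {n} \<times> {..<p})"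
      using disj[of "(i, 0)" "(i', 0)" for i i']
      by (subst card_UN_disjoint) (auto simp: R_def group_players_def set_eq_iff)
    also have "\<dots> \<le> card ({n} \<times> {..<p})"
      by (intro card_mono) auto
    finally show ?thesis by simp
  qed
  have "allocation_value (group_instance n p) S = (\<Sum>i<n. \<Sum>l\<le>p. v (i, l))"
    by (simp add: allocation_value_def sum_players_group_instance v_def)
  also have "\<dots> \<le> (\<Sum>i<n. real n + (if i \<in> R then real p else 0))"
    using with_big without_big by (intro sum_mono) auto
  also have "\<dots> = n * n + card R * p"
  proof -
    have "{..<n} \<inter> R = R"
      by (auto simp: R_def)
    then show ?thesis
      by (simp add: sum.distrib sum.inter_restrict[symmetric])
  qed
  also have "\<dots> \<le> n * n + p * p"
    using card_R by (simp add: mult_right_mono flip: of_nat_mult)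
  finally show "allocation_value (group_instance n p) S \<le> real (n * n + p * p)"
    by simp
qed

section \<open>The choice of the ratio p / n\<close>

text \<open>As \<open>s\<close> is a root of x^2 + 2x - 1, the excess over 2s is exactly (t - s)^2 /
  (1 + t). With \<open>e \<le> 1\<close> the square is at most \<open>e\<close>.\<close>

lemma group_ratio_le:
  fixes s t :: real
  assumes s: "s = sqrt 2 - 1" and t: "0 \<le> t" "\<bar>t - s\<bar> \<le> e" "e \<le> 1"
  shows "(1 + t\<^sup>2) / (1 + t) \<le> 2 * s + e"
proof -
  have "s\<^sup>2 = 1 - 2 * s"
    by (simp add: s power2_diff)
  then have "(1 + t\<^sup>2) / (1 + t) - 2 * s = (t - s)\<^sup>2 / (1 + t)"
    using t(1) by (simp add: field_simps power2_diff)
  also have "\<dots> \<le> (t - s)\<^sup>2"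
    using t(1) by (simp add: divide_le_eq mult_le_cancel_left1)
  also have "\<dots> = \<bar>t - s\<bar> * \<bar>t - s\<bar>"
    by (simp add: power2_eq_square)
  also have "\<dots> \<le> e * 1"
    using t by (intro mult_mono) auto
  finally show ?thesis by simp
qed

lemma integrality_gap_instance:
  fixes \<eta> :: real
  assumes "0 < \<eta>"
  shows "\<exists>I :: (nat, nat) mba. mba_instance I \<and> 0 < opt_config_lp I \<and>
     opt_integral I / opt_config_lp I \<le> 2 * (sqrt 2 - 1) + \<eta>"
proof -
  define s :: real where "s = sqrt 2 - 1"
  have s: "0 \<le> s" "s \<le> 1"
    using real_sqrt_le_mono[of 2 4] by (auto simp: s_def)
  obtain m where m: "1 / real (Suc m) < \<eta>"
    using reals_Archimedean[OF assms] by (auto simp: inverse_eq_divide)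
  define n where "n = Suc m"
  \<comment> \<open>Rounding s * n down puts p / n within 1/n of the minimiser \<open>s\<close>, and
    \<open>s \<le> 1\<close> ensures \<open>p \<le> n\<close>.\<close>
  define p where "p = nat \<lfloor>s * n\<rfloor>"
  define I where "I = group_instance n p"
  have n: "0 < n"
    by (simp add: n_def)
  have p_le: "real p \<le> s * n" and p_ge: "s * n - 1 \<le> real p"
    using s(1) by (auto simp: p_def)
  have "real p \<le> real n"
    using p_le mult_right_mono[OF s(2), of "real n"] by simp
  then have lp: "real (n * n + n * p) \<le> opt_config_lp I"
    unfolding I_def using n by (intro opt_config_lp_group_instance) auto
  have pos: "0 < real (n * n + n * p)"
    using n by (simp add: add_pos_nonneg)
  \<comment> \<open>The LP value stands in the denominator, so its lower bound suffices.\<close>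
  have "opt_integral I / opt_config_lp I \<le> real (n * n + p * p) / real (n * n + n * p)"
    using lp pos opt_integral_group_instance[of n p]
    by (intro frac_le) (auto simp: I_def)
  also have "\<dots> = (1 + (p / n)\<^sup>2) / (1 + p / n)"
  proof -
    have "real (n * n + p * p) = (n * n) * (1 + (p / n)\<^sup>2)"
      and "real (n * n + n * p) = (n * n) * (1 + p / n)"
      using n by (auto simp: field_simps power2_eq_square)
    then show ?thesis
      using n by (simp only: mult_divide_mult_cancel_left) simp
  qed
  also have "\<dots> \<le> 2 * s + 1 / n"
  proof (rule group_ratio_le[OF s_def])
    show "\<bar>real p / n - s\<bar> \<le> 1 / n"
    proof -
      have "real p / n - s = (p - s * n) / n"
        using n by (simp add: field_simps)
      moreover have "\<bar>p - s * n\<bar> \<le> 1"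
        using p_le p_ge by (simp add: abs_le_iff)
      ultimately show ?thesis
        by (simp add: abs_divide divide_right_mono)
    qed
  qed (use n in auto)
  also have "\<dots> \<le> 2 * (sqrt 2 - 1) + \<eta>"
    using m by (simp add: s_def n_def)
  finally show ?thesis
    using lp pos mba_instance_group_instance[of n p] unfolding I_def
    by (intro exI[of _ "group_instance n p"]) auto
qed

theorem theorem5:
  "config_lp_integrality_gap \<le> 2 * (sqrt 2 - 1) \<and>
   (\<forall>\<eta>>0. \<exists>I :: (nat, nat) mba.
      mba_instance I \<and> 0 < opt_config_lp I \<and>
      opt_integral I / opt_config_lp I \<le> 2 * (sqrt 2 - 1) + \<eta>)"
proof (intro conjI allI impI integrality_gap_instance)
  show "config_lp_integrality_gap \<le> 2 * (sqrt 2 - 1)"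
    \<comment> \<open>The infimum is below the ratio of the instance found for each positive slack;
      the slack then tends to 0.\<close>
    by (rule field_le_epsilon)
      (meson integrality_gap_instance config_lp_integrality_gap_le order_trans)
qed

end
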